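(* Let $\ell\ge 2$ be an integer. Let $(A_1,A_2)$ be the random-walk approximation with block length $\ell$ and parameter $\eta$, let $s_{A_2}$ be the stopping time of $A_2$ (the approximated classification time for a block of $\ell$ cells in state 1), and let $G_{II}(\ell,s)=\sum_{k\ge0}\mathbf P(s_{A_2}=k)\,s^k$ be its generating function. If $\eta\approx 0$, the expected value for the classification time for blocks is $$G_{II}'(\ell,1)=\frac{\ell-\eta\ell-\eta}{\eta-2\eta^2},$$ where the derivative is taken with respect to $s$.
   Context: The traffic-majority rule $\phi_\eta$, $\eta\in[0,1]$, is the two-state stochastic cellular automaton rule of radius 1 in which a cell with left neighbour, own state and right neighbour $(a,b,c)$ is in state 1 at the next time step, independently of the other cells, with probability $\phi_\eta(a,b,c)$, where $\phi_\eta(0,0,0)=\phi_\eta(0,0,1)=\phi_\eta(0,1,0)=0$, $\phi_\eta(1,0,1)=\phi_\eta(1,1,1)=\phi_\eta(0,1,1)=1$, $\phi_\eta(1,0,0)=1-\eta$, $\phi_\eta(1,1,0)=\eta$. The initial configuration is a block of $\ell$ consecutive cells in state 1 on a ring of cells otherwise in state 0; the classification time (for blocks that are in the minority) is the first time at which all cells are in state 0. It is approximated by the following random-walk model. A $p$-walk ($p\in[0,1]$) is a random walk on $\mathbb Z$ in which each step is $+1$ with probability $p$ and $-1$ with probability $1-p$, up to a (possibly infinite) stopping time. The random-walk approximation with block length $\ell$ and parameter $\eta$ is a pair $(A_1,A_2)$ of independent walks (independent apart from the stopping rule of $A_2$), both starting at $\ell-1$ at time $t=0$: - $A_1$ is an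 $\eta$-walk that ends at $s_{A_1}$, the first time $t$ with $A_{1,t}=0$. - $A_2$ is a $(1-\eta)$-walk that ends at $s_{A_2}$, the first time $t$ with $t-A_{2,t}=s_{A_1}+2$. A stopping time is $\infty$ if no such time exists. The condition "$\eta\approx0$" is informal. *)

theory Defs
  imports "HOL-Probability.Probability"
begin

(* The walk is not frozen when it stops: all the stopping times below are functions of a walk that
   is continued for ever. *)
definition p_walk :: "'w measure \<Rightarrow> real \<Rightarrow> int \<Rightarrow> (nat \<Rightarrow> 'w \<Rightarrow> int) \<Rightarrow> bool" where
  "p_walk M p a A \<longleftrightarrow>
     prob_space M \<and>
     (\<forall>\<omega>\<in>space M. A 0 \<omega> = a) \<and>
     prob_space.indep_vars M (\<lambda>_. count_space UNIV) (\<lambda>t \<omega>. A (Suc t) \<omega> - A t \<omega>) UNIV \<and>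
     (\<forall>t. measure M {\<omega> \<in> space M. A (Suc t) \<omega> - A t \<omega> = 1} = p \<and>
          measure M {\<omega> \<in> space M. A (Suc t) \<omega> - A t \<omega> = - 1} = 1 - p)"

definition independent_walks ::
    "'w measure \<Rightarrow> (nat \<Rightarrow> 'w \<Rightarrow> int) \<Rightarrow> (nat \<Rightarrow> 'w \<Rightarrow> int) \<Rightarrow> bool" where
  "independent_walks M A B \<longleftrightarrow>
     prob_space.indep_var M
       (Pi\<^sub>M UNIV (\<lambda>_. count_space UNIV)) (\<lambda>\<omega> t. A t \<omega>)
       (Pi\<^sub>M UNIV (\<lambda>_. count_space UNIV)) (\<lambda>\<omega> t. B t \<omega>)"

definition random_walk_approximation ::
    "'w measure \<Rightarrow> nat \<Rightarrow> real \<Rightarrow> (nat \<Rightarrow> 'w \<Rightarrow> int) \<Rightarrow> (nat \<Rightarrow> 'w \<Rightarrow> int) \<Rightarrow> bool" where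
  "random_walk_approximation M l \<eta> A1 A2 \<longleftrightarrow>
     p_walk M \<eta> (int l - 1) A1 \<and>
     p_walk M (1 - \<eta>) (int l - 1) A2 \<and>
     independent_walks M A1 A2"

definition first_time :: "(nat \<Rightarrow> bool) \<Rightarrow> enat" where
  "first_time P = (if \<exists>t. P t then enat (LEAST t. P t) else \<infinity>)"

definition s_A1 :: "(nat \<Rightarrow> 'w \<Rightarrow> int) \<Rightarrow> 'w \<Rightarrow> enat" where
  "s_A1 A1 \<omega> = first_time (\<lambda>t. A1 t \<omega> = 0)"

(* If the first walk never stops, then neither does the second. *)
definition s_A2 :: "(nat \<Rightarrow> 'w \<Rightarrow> int) \<Rightarrow> (nat \<Rightarrow> 'w \<Rightarrow> int) \<Rightarrow> 'w \<Rightarrow> enat" where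
  "s_A2 A1 A2 \<omega> =
     first_time (\<lambda>t. \<exists>n. s_A1 A1 \<omega> = enat n \<and> int t - A2 t \<omega> = int n + 2)"

(* The block length enters through the starting point of the two walks. *)
definition G_II ::
    "'w measure \<Rightarrow> (nat \<Rightarrow> 'w \<Rightarrow> int) \<Rightarrow> (nat \<Rightarrow> 'w \<Rightarrow> int) \<Rightarrow> real \<Rightarrow> real" where
  "G_II M A1 A2 s = (\<Sum>k. measure M {\<omega> \<in> space M. s_A2 A1 A2 \<omega> = enat k} * s ^ k)"

end

theory Submission
  imports Defs
begin

text \<open>
  Both stopping times are first passages to 0 of a walk with negative drift that moves down by
  exactly \<open>d\<close> or up by \<open>e\<close>, where \<open>d\<close> divides both \<open>e\<close> and the starting point, so that 0
  cannot be jumped over. For such a walk \<open>X\<close> with drift \<open>-\<delta>\<close> started at \<open>a\<close>, stopping one step at a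
  time gives \<open>E[X\<^sub>n; T > n] = a - \<delta> (P(T > 0) + ... + P(T > n - 1))\<close> and, for \<open>\<rho> > 1\<close>,
  \<open>E[\<rho>\<^bsup>X n\<^esup>; T > n] \<le> \<rho>\<^sup>a \<phi>(\<rho>)\<^sup>n\<close>, where \<open>\<phi>(\<rho>)\<close> is the mean of \<open>\<rho>\<close> to the power of one step.
  As \<open>\<phi>(\<rho>) < 1\<close> for some \<open>\<rho> > 1\<close>, the tail of \<open>T\<close> is geometric and \<open>E T = a / \<delta>\<close>.

  Given \<open>s\<^bsub>A1\<^esub> = n\<close>, the walk \<open>n + 2 - (t - A\<^bsub>2,t\<^esub>)\<close> is of this kind with \<open>d = 2\<close>, \<open>e = 0\<close> and start
  \<open>n + \<ell> + 1\<close> (which is even almost surely), so \<open>E s\<^bsub>A2\<^esub> = (E s\<^bsub>A1\<^esub> + \<ell> + 1) / (2\<eta>)\<close> with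
  \<open>E s\<^bsub>A1\<^esub> = (\<ell> - 1) / (1 - 2\<eta>)\<close>. An exponential moment of \<open>s\<^bsub>A1\<^esub>\<close> makes the tail of \<open>s\<^bsub>A2\<^esub>\<close>
  geometric too, so the generating function converges beyond 1 and may be differentiated there.
\<close>

section \<open>First times and measurability on discrete spaces\<close>

lemma first_time_eq_enat_iff:
  "first_time P = enat n \<longleftrightarrow> P n \<and> (\<forall>k<n. \<not> P k)"
  unfolding first_time_def
  by (auto intro: LeastI dest: not_less_Least intro!: Least_equality simp: not_less[symmetric])

lemma enat_less_first_time_iff:
  "enat n < first_time P \<longleftrightarrow> (\<forall>k\<le>n. \<not> P k)"
proof (cases "\<exists>t. P t")
  case True
  then have "P (LEAST t. P t)"
    by (metis LeastI)
  moreover have "(LEAST t. P t) \<le> k" if "P k" for k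
    using that by (rule Least_le)
  ultimately have "n < (LEAST t. P t) \<longleftrightarrow> (\<forall>k\<le>n. \<not> P k)"
    by (metis leD le_less_trans not_less)
  with True show ?thesis
    unfolding first_time_def by auto
qed (auto simp: first_time_def)

lemma measurable_first_time [measurable (raw)]:
  assumes [measurable]: "\<And>t. Measurable.pred M (P t)"
  shows "(\<lambda>x. first_time (\<lambda>t. P t x)) \<in> measurable M (count_space UNIV)"
  unfolding first_time_def by measurable

text \<open>Each addition is split over the countably many values of one summand; adding a fixed
  value is measurable.\<close>

lemma measurable_sum_count_space:
  fixes f :: "'i \<Rightarrow> 'x \<Rightarrow> 'b :: {countable, comm_monoid_add}"
  assumes "\<And>i. i \<in> I \<Longrightarrow> f i \<in> measurable M (count_space UNIV)"
  shows "(\<lambda>x. \<Sum>i\<in>I. f i x) \<in> measurable M (count_space UNIV)"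
  using assms
proof (induction I rule: infinite_finite_induct)
  case (insert i I)
  then have [measurable]: "f i \<in> measurable M (count_space UNIV)"
    "(\<lambda>x. \<Sum>j\<in>I. f j x) \<in> measurable M (count_space UNIV)"
    by auto
  have "(\<lambda>x. f i x + (\<Sum>j\<in>I. f j x)) \<in> measurable M (count_space UNIV)"
    by (rule measurable_compose_countable[where f = "\<lambda>y x. y + (\<Sum>j\<in>I. f j x)" and g = "f i"])
      measurable
  with insert show ?case by simp
qed auto

section \<open>Random variables in \<open>enat\<close>: means, generating functions,
  mixtures\<close>

lemma (in prob_space) nn_integral_AE_finite_enat:
  assumes [measurable]: "T \<in> measurable M (count_space UNIV)"
    and fin: "AE \<omega> in M. T \<omega> \<noteq> \<infinity>"
  shows "(\<integral>\<^sup>+\<omega>. g (T \<omega>) \<partial>M) = (\<Sum>n. g (enat n) * emeasure M {\<omega>\<in>space M. T \<omega> = enat n})"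
proof -
  have "(\<integral>\<^sup>+\<omega>. g (T \<omega>) \<partial>M)
      = (\<integral>\<^sup>+\<omega>. (\<Sum>n. g (enat n) * indicator {\<omega>\<in>space M. T \<omega> = enat n} \<omega>) \<partial>M)"
  proof (rule nn_integral_cong_AE, use fin AE_space in eventually_elim)
    fix \<omega> assume "T \<omega> \<noteq> \<infinity>" and \<omega>: "\<omega> \<in> space M"
    then obtain m where m: "T \<omega> = enat m" by auto
    have "(\<Sum>n. g (enat n) * indicator {\<omega>\<in>space M. T \<omega> = enat n} \<omega>)
        = (\<Sum>n\<in>{m}. g (enat n) * indicator {\<omega>\<in>space M. T \<omega> = enat n} \<omega>)"
      by (rule suminf_finite) (auto simp: m)
    then show "g (T \<omega>) = (\<Sum>n. g (enat n) * indicator {\<omega>\<in>space M. T \<omega> = enat n} \<omega>)"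
      using \<omega> by (simp add: m)
  qed
  also have "\<dots> = (\<Sum>n. \<integral>\<^sup>+\<omega>. g (enat n) * indicator {\<omega>\<in>space M. T \<omega> = enat n} \<omega> \<partial>M)"
    by (rule nn_integral_suminf) simp
  finally show ?thesis
    by (simp add: nn_integral_cmult)
qed

text \<open>Since P(T = k + 1) is at most P(T > k), the probabilities decay like
  \<open>x ^ k\<close>, so any r strictly between 1 and 1/x works.\<close>

lemma (in prob_space) geometric_tail_summable:
  fixes T :: "'a \<Rightarrow> enat"
  assumes [measurable]: "T \<in> measurable M (count_space UNIV)"
    and tail: "\<And>k. prob {\<omega>\<in>space M. enat k < T \<omega>} \<le> C * x ^ k" and x: "0 \<le> x" "x < 1"
  shows "\<exists>r>1. summable (\<lambda>k. prob {\<omega>\<in>space M. T \<omega> = enat k} * r ^ k)"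
proof -
  define p where "p k = prob {\<omega>\<in>space M. T \<omega> = enat k}" for k
  \<comment> \<open>\<open>x\<close> may be 0, so a positive rate \<open>y\<close> takes its place;
    \<open>r\<close> is the midpoint of 1 and 1/y, which gives
    \<open>r * y = (1 + y) / 2 < 1\<close>.\<close>
  define y where "y = max x (1 / 2)"
  define r where "r = (1 + 1 / y) / 2"
  have y: "0 < y" "y < 1" "x \<le> y"
    using x by (auto simp: y_def)
  then have r: "1 < r"
    by (simp add: r_def field_simps)
  have "r * y = (1 + y) / 2"
    using y by (simp add: r_def field_simps)
  then have ry: "0 < r * y" "r * y < 1"
    using y by auto
  have "0 \<le> C"
    using order.trans[OF measure_nonneg tail[of 0]] by simp
  have p_nonneg: "0 \<le> p k" for k
    by (simp add: p_def)
  have bound: "norm (p (Suc k) * r ^ Suc k) \<le> (C * r) * (r * y) ^ k" for k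
  proof -
    have "p (Suc k) \<le> prob {\<omega>\<in>space M. enat k < T \<omega>}"
      unfolding p_def by (rule finite_measure_mono) auto
    also have "\<dots> \<le> C * x ^ k" by (rule tail)
    also have "\<dots> \<le> C * y ^ k"
      using \<open>0 \<le> C\<close> x y by (intro mult_left_mono power_mono) auto
    finally have "p (Suc k) * r ^ Suc k \<le> C * y ^ k * r ^ Suc k"
      using r by (intro mult_right_mono) auto
    then show ?thesis
      using p_nonneg[of "Suc k"] r by (simp add: power_mult_distrib mult_ac)
  qed
  have "summable (\<lambda>k. (C * r) * (r * y) ^ k)"
    using ry by (intro summable_mult summable_geometric) auto
  then have "summable (\<lambda>k. p (Suc k) * r ^ Suc k)"
    by (rule summable_comparison_test') (rule bound)
  then have "summable (\<lambda>k. p k * r ^ k)"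
    using summable_Suc_iff[of "\<lambda>k. p k * r ^ k"] by blast
  with r show ?thesis
    unfolding p_def by blast
qed

text \<open>The point 1 lies inside the disc of convergence, so the series may be differentiated
  termwise there. The result, the sum of k P(T = k), is the mean because a finite mean leaves no
  mass at infinity.\<close>

lemma (in prob_space) generating_function_derivative:
  fixes T :: "'a \<Rightarrow> enat"
  assumes [measurable]: "T \<in> measurable M (count_space UNIV)"
    and "1 < r" and sm: "summable (\<lambda>k. prob {\<omega>\<in>space M. T \<omega> = enat k} * r ^ k)"
    and mean: "(\<integral>\<^sup>+\<omega>. ennreal_of_enat (T \<omega>) \<partial>M) = ennreal E" and "0 \<le> E"
  shows "((\<lambda>s. \<Sum>k. prob {\<omega>\<in>space M. T \<omega> = enat k} * s ^ k) has_real_derivative E) (at 1)"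
proof -
  define p where "p k = prob {\<omega>\<in>space M. T \<omega> = enat k}" for k
  have sm_p: "summable (\<lambda>k. p k * x ^ k)" if "norm x < r" for x
    using powser_inside[of p r x] sm that \<open>1 < r\<close> by (simp add: p_def)
  have "summable (\<lambda>k. diffs p k * 1 ^ k)"
    by (rule termdiff_converges[where K = r]) (use \<open>1 < r\<close> sm_p in auto)
  \<comment> \<open>\<open>diffs p k\<close> is (k + 1) p(k + 1); the index shift is harmless
    because the term k = 0 vanishes.\<close>
  from diffs_equiv[OF this] have sums: "(\<lambda>k. real k * p k) sums (\<Sum>k. diffs p k * 1 ^ k)"
    by simp
  have "AE \<omega> in M. ennreal_of_enat (T \<omega>) \<noteq> \<infinity>"
    by (rule nn_integral_PInf_AE) (simp_all add: mean)
  then have fin: "AE \<omega> in M. T \<omega> \<noteq> \<infinity>"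
    by eventually_elim (metis ennreal_of_enat_infty infinity_ennreal_def)
  have "ennreal E = (\<Sum>k. ennreal_of_enat (enat k) * emeasure M {\<omega>\<in>space M. T \<omega> = enat k})"
    unfolding mean[symmetric] by (rule nn_integral_AE_finite_enat[OF _ fin]) measurable
  also have "\<dots> = (\<Sum>k. ennreal (real k * p k))"
    by (simp add: p_def emeasure_eq_measure ennreal_mult ennreal_of_nat_eq_real_of_nat)
  also have "\<dots> = ennreal (\<Sum>k. diffs p k * 1 ^ k)"
    by (rule suminf_ennreal_eq[OF _ sums]) (simp add: p_def)
  finally have "E = (\<Sum>k. diffs p k * 1 ^ k)"
    using \<open>0 \<le> E\<close> sums_le[OF _ sums_zero sums] by (subst (asm) ennreal_inj) (auto simp: p_def)
  moreover have "((\<lambda>s. \<Sum>k. p k * s ^ k) has_real_derivative (\<Sum>k. diffs p k * 1 ^ k)) (at 1)"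
    by (rule termdiffs_strong[where K = r]) (use \<open>1 < r\<close> sm in \<open>auto simp: p_def\<close>)
  ultimately show ?thesis
    by (simp add: p_def)
qed

text \<open>\<open>U n\<close> is what \<open>T\<close> becomes when \<open>S\<close> is frozen at
  \<open>n\<close>. The event is split by the value of \<open>S\<close>, and independence factors
  each piece.\<close>

lemma (in prob_space) mixture_tail:
  fixes S T :: "'a \<Rightarrow> enat" and U :: "nat \<Rightarrow> 'a \<Rightarrow> enat"
  assumes [measurable]: "T \<in> measurable M (count_space UNIV)"
    and fin: "AE \<omega> in M. S \<omega> \<noteq> \<infinity>"
    and indep: "\<And>n. indep_var (count_space UNIV) S (count_space UNIV) (U n)"
    and eq: "\<And>n \<omega>. S \<omega> = enat n \<Longrightarrow> T \<omega> = U n \<omega>"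
  shows "emeasure M {\<omega>\<in>space M. k < T \<omega>}
    = (\<Sum>n. emeasure M {\<omega>\<in>space M. S \<omega> = enat n} * emeasure M {\<omega>\<in>space M. k < U n \<omega>})"
proof -
  have [measurable]: "S \<in> measurable M (count_space UNIV)" "U n \<in> measurable M (count_space UNIV)" for n
    using indep_var_rv1[OF indep] indep_var_rv2[OF indep] by auto
  let ?F = "\<lambda>n. {\<omega>\<in>space M. S \<omega> = enat n \<and> k < U n \<omega>}"
  have factor: "emeasure M (?F n)
      = emeasure M {\<omega>\<in>space M. S \<omega> = enat n} * emeasure M {\<omega>\<in>space M. k < U n \<omega>}" for n
  proof -
    have "(\<lambda>\<omega>. (S \<omega>, U n \<omega>)) -` ({enat n} \<times> {k<..}) \<inter> space M = ?F n"
      and "S -` {enat n} \<inter> space M = {\<omega>\<in>space M. S \<omega> = enat n}"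
      and "U n -` {k<..} \<inter> space M = {\<omega>\<in>space M. k < U n \<omega>}"
      by auto
    then show ?thesis
      using indep_varD[OF indep, of "{enat n}" "{k<..}" n] by (simp add: emeasure_eq_measure ennreal_mult)
  qed
  have "emeasure M {\<omega>\<in>space M. k < T \<omega>} = emeasure M (\<Union>n. ?F n)"
  proof (rule emeasure_eq_AE)
    show "AE \<omega> in M. \<omega> \<in> {\<omega>\<in>space M. k < T \<omega>} \<longleftrightarrow> \<omega> \<in> (\<Union>n. ?F n)"
      using fin by eventually_elim (use eq in auto)
  qed measurable
  also have "\<dots> = (\<Sum>n. emeasure M (?F n))"
    by (rule suminf_emeasure[symmetric]) (auto simp: disjoint_family_on_def)
  finally show ?thesis
    by (simp only: factor)
qed

text \<open>The mean is the sum over k of the tails P(T > k); \<open>mixture_tail\<close> applies to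
  each, and the two nonnegative sums are exchanged.\<close>

lemma (in prob_space) mixture_mean:
  fixes S T :: "'a \<Rightarrow> enat" and U :: "nat \<Rightarrow> 'a \<Rightarrow> enat"
  assumes [measurable]: "T \<in> measurable M (count_space UNIV)"
    and fin: "AE \<omega> in M. S \<omega> \<noteq> \<infinity>"
    and indep: "\<And>n. indep_var (count_space UNIV) S (count_space UNIV) (U n)"
    and eq: "\<And>n \<omega>. S \<omega> = enat n \<Longrightarrow> T \<omega> = U n \<omega>"
  shows "(\<integral>\<^sup>+\<omega>. ennreal_of_enat (T \<omega>) \<partial>M)
    = (\<Sum>n. emeasure M {\<omega>\<in>space M. S \<omega> = enat n} * (\<integral>\<^sup>+\<omega>. ennreal_of_enat (U n \<omega>) \<partial>M))"
proof -
  have [measurable]: "U n \<in> measurable M (count_space UNIV)" for n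
    using indep_var_rv2[OF indep] by auto
  let ?a = "\<lambda>n. emeasure M {\<omega>\<in>space M. S \<omega> = enat n}"
  let ?b = "\<lambda>n k. emeasure M {\<omega>\<in>space M. enat k < U n \<omega>}"
  have "(\<integral>\<^sup>+\<omega>. ennreal_of_enat (T \<omega>) \<partial>M) = (\<Sum>k. \<Sum>n. ?a n * ?b n k)"
    by (subst nn_integral_enat_function) (auto simp: mixture_tail[OF _ fin indep eq])
  \<comment> \<open>Reading the inner sum as an integral over the counting measure turns the
    exchange into an instance of \<open>nn_integral_suminf\<close>.\<close>
  also have "\<dots> = (\<Sum>k. \<integral>\<^sup>+n. ?a n * ?b n k \<partial>count_space UNIV)"
    by (simp add: nn_integral_count_space_nat)
  also have "\<dots> = (\<integral>\<^sup>+n. (\<Sum>k. ?a n * ?b n k) \<partial>count_space UNIV)"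
    by (rule nn_integral_suminf[symmetric]) simp
  also have "\<dots> = (\<Sum>n. ?a n * (\<Sum>k. ?b n k))"
    by (simp add: nn_integral_count_space_nat)
  also have "\<dots> = (\<Sum>n. ?a n * (\<integral>\<^sup>+\<omega>. ennreal_of_enat (U n \<omega>) \<partial>M))"
    by (simp add: nn_integral_enat_function)
  finally show ?thesis .
qed

section \<open>First passage of walks that cannot jump over 0\<close>

text \<open>\<open>q\<close> is the probability of a step down. It is instantiated with
  \<open>d = e = 1\<close> for the first walk and with \<open>d = 2\<close>, \<open>e = 0\<close>
  for the distance of the second from its target.\<close>

locale skip_free_walk = prob_space M for M :: "'w measure" +
  fixes X :: "nat \<Rightarrow> 'w \<Rightarrow> int" and a d e :: nat and q :: real
  assumes start: "\<And>\<omega>. \<omega> \<in> space M \<Longrightarrow> X 0 \<omega> = int a"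
    and indep_steps: "indep_vars (\<lambda>_. count_space UNIV) (\<lambda>t \<omega>. X (Suc t) \<omega> - X t \<omega>) UNIV"
    and prob_down: "\<And>t. prob {\<omega>\<in>space M. X (Suc t) \<omega> - X t \<omega> = - int d} = q"
    and prob_up: "\<And>t. prob {\<omega>\<in>space M. X (Suc t) \<omega> - X t \<omega> = int e} = 1 - q"
    and d_pos: "0 < d" and d_dvd_a: "d dvd a" and d_dvd_e: "d dvd e"
    and drift: "(1 - q) * real e < q * real d"
begin

abbreviation step :: "nat \<Rightarrow> 'w \<Rightarrow> int" where
  "step t \<omega> \<equiv> X (Suc t) \<omega> - X t \<omega>"

definition hit :: "'w \<Rightarrow> enat" where
  "hit \<omega> = first_time (\<lambda>t. X t \<omega> = 0)"

text \<open>This is the event \<open>hit > n\<close>, written so that it visibly depends only on the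
  steps before time \<open>n\<close>.\<close>

definition alive :: "nat \<Rightarrow> 'w \<Rightarrow> bool" where
  "alive n \<omega> \<longleftrightarrow> (\<forall>k\<le>n. X k \<omega> \<noteq> 0)"

lemma step_measurable [measurable]: "step t \<in> measurable M (count_space UNIV)"
  using indep_steps by (auto simp: indep_vars_def)

lemma X_eq_sum: "\<omega> \<in> space M \<Longrightarrow> X n \<omega> = int a + (\<Sum>k<n. step k \<omega>)"
  by (induction n) (auto simp: start)

text \<open>Measurability of the steps is part of their independence; the positions inherit it as
  sums of steps.\<close>

lemma X_measurable [measurable]: "X n \<in> measurable M (count_space UNIV)"
proof -
  have [measurable]: "(\<lambda>\<omega>. \<Sum>k<n. step k \<omega>) \<in> measurable M (count_space UNIV)"
    by (intro measurable_sum_count_space step_measurable)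
  have "(\<lambda>\<omega>. int a + (\<Sum>k<n. step k \<omega>)) \<in> measurable M (count_space UNIV)"
    by measurable
  then show ?thesis
    by (rule measurable_cong[THEN iffD1, rotated]) (erule X_eq_sum[symmetric])
qed

lemma hit_measurable [measurable]: "hit \<in> measurable M (count_space UNIV)"
  unfolding hit_def by measurable

lemma alive_measurable [measurable]: "Measurable.pred M (alive n)"
  unfolding alive_def by measurable

lemma less_hit_iff: "enat n < hit \<omega> \<longleftrightarrow> alive n \<omega>"
  by (simp add: hit_def alive_def enat_less_first_time_iff)

text \<open>The two events are disjoint because -d < 0 \<le> e, and their probabilities
  \<open>q\<close> and \<open>1 - q\<close> exhaust the total mass.\<close>

lemma AE_step: "AE \<omega> in M. step t \<omega> = - int d \<or> step t \<omega> = int e"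
proof -
  have "prob ({\<omega>\<in>space M. step t \<omega> = - int d} \<union> {\<omega>\<in>space M. step t \<omega> = int e}) = 1"
    using d_pos by (subst finite_measure_Union) (auto simp: prob_down prob_up)
  then have "AE \<omega> in M. \<omega> \<in> {\<omega>\<in>space M. step t \<omega> = - int d} \<union> {\<omega>\<in>space M. step t \<omega> = int e}"
    by (subst (asm) prob_eq_1) auto
  then show ?thesis
    by eventually_elim auto
qed

lemma AE_steps: "AE \<omega> in M. \<forall>t. step t \<omega> = - int d \<or> step t \<omega> = int e"
  using AE_step by (simp add: AE_all_countable)

section \<open>Expectations across one more step\<close>

lemma step_expectation:
  fixes h :: "int \<Rightarrow> real"
  shows "integrable M (\<lambda>\<omega>. h (step t \<omega>))"
    and "expectation (\<lambda>\<omega>. h (step t \<omega>)) = q * h (- int d) + (1 - q) * h (int e)"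
proof -
  let ?f = "\<lambda>\<omega>. h (- int d) * indicator {\<omega>\<in>space M. step t \<omega> = - int d} \<omega>
    + h (int e) * indicator {\<omega>\<in>space M. step t \<omega> = int e} \<omega>"
  have eq: "AE \<omega> in M. h (step t \<omega>) = ?f \<omega>"
    using AE_step[of t] AE_space by eventually_elim (use d_pos in \<open>auto simp: indicator_def\<close>)
  have int: "integrable M ?f"
    by (intro Bochner_Integration.integrable_add integrable_mult_right integrable_real_indicator)
       (auto simp: emeasure_eq_measure)
  show "integrable M (\<lambda>\<omega>. h (step t \<omega>))"
    by (rule integrable_cong_AE[THEN iffD2, OF _ _ eq int]) simp_all
  have "expectation (\<lambda>\<omega>. h (step t \<omega>)) = expectation ?f"
    by (rule integral_cong_AE[OF _ _ eq]) simp_all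
  also have "\<dots> = q * h (- int d) + (1 - q) * h (int e)"
    by (subst Bochner_Integration.integral_add)
      (auto simp: prob_down prob_up emeasure_eq_measure mult.commute
        intro!: integrable_mult_right integrable_real_indicator)
  finally show "expectation (\<lambda>\<omega>. h (step t \<omega>)) = q * h (- int d) + (1 - q) * h (int e)" .
qed

text \<open>\<open>X n\<close> and \<open>alive n\<close> are functions of the steps before time
  \<open>n\<close>, hence independent of \<open>step n\<close>, so the expectation of the product
  factors. Both moment recursions below rest on this.\<close>

lemma expectation_past_step:
  fixes f :: "int \<Rightarrow> bool \<Rightarrow> real" and h :: "int \<Rightarrow> real"
  assumes int: "integrable M (\<lambda>\<omega>. f (X n \<omega>) (alive n \<omega>))"
  shows "integrable M (\<lambda>\<omega>. f (X n \<omega>) (alive n \<omega>) * h (step n \<omega>))"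
    and "expectation (\<lambda>\<omega>. f (X n \<omega>) (alive n \<omega>) * h (step n \<omega>))
      = expectation (\<lambda>\<omega>. f (X n \<omega>) (alive n \<omega>)) * (q * h (- int d) + (1 - q) * h (int e))"
proof -
  \<comment> \<open>\<open>?S\<close> and \<open>?F\<close> rebuild the positions and the integrand
    from the tuple of the first \<open>n\<close> steps, which exhibits the past as a measurable
    function of that tuple.\<close>
  let ?S = "\<lambda>k (x :: nat \<Rightarrow> int). int a + (\<Sum>i<k. x i)"
  let ?P = "PiM {..<n} (\<lambda>_. count_space UNIV :: int measure)"
  let ?F = "\<lambda>x. f (?S n x) (\<forall>k\<in>{..n}. ?S k x \<noteq> 0)"
  let ?past = "\<lambda>\<omega>. \<lambda>i\<in>{..<n}. step i \<omega>"
  have S [measurable]: "?S k \<in> measurable ?P (count_space UNIV)" if "k \<in> {..n}" for k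
  proof -
    have [measurable]: "(\<lambda>x. \<Sum>i<k. x i) \<in> measurable ?P (count_space UNIV)"
      using that by (intro measurable_sum_count_space measurable_component_singleton) auto
    show ?thesis by measurable
  qed
  have [measurable]: "?S n \<in> measurable ?P (count_space UNIV)"
    by (rule S) simp
  have [measurable]: "Measurable.pred ?P (\<lambda>x. \<forall>k\<in>{..n}. ?S k x \<noteq> 0)"
    by measurable
  have F: "?F \<in> borel_measurable ?P"
    by measurable
  have G: "(\<lambda>x. h (x n)) \<in> borel_measurable (PiM {n} (\<lambda>_. count_space UNIV :: int measure))"
    by measurable
  \<comment> \<open>The index sets \<open>{..<n}\<close> and \<open>{n}\<close> are
    disjoint.\<close>
  have "indep_var ?P ?past (PiM {n} (\<lambda>_. count_space UNIV)) (\<lambda>\<omega>. \<lambda>i\<in>{n}. step i \<omega>)"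
    by (rule indep_var_restrict[OF indep_steps]) auto
  from indep_var_compose[OF this F G]
  have *: "indep_var borel (\<lambda>\<omega>. ?F (?past \<omega>)) borel (\<lambda>\<omega>. h (step n \<omega>))"
    by (simp add: comp_def)
  have sum_eq: "?S k (?past \<omega>) = X k \<omega>" if "k \<le> n" "\<omega> \<in> space M" for k \<omega>
    using that by (subst X_eq_sum) (auto intro!: sum.cong)
  have F_eq: "?F (?past \<omega>) = f (X n \<omega>) (alive n \<omega>)" if "\<omega> \<in> space M" for \<omega>
  proof -
    have "(\<forall>k\<in>{..n}. ?S k (?past \<omega>) \<noteq> 0) \<longleftrightarrow> alive n \<omega>"
      unfolding alive_def using sum_eq[OF _ that] by (auto simp del: restrict_apply)
    then show ?thesis
      using sum_eq[OF order.refl that] by (simp del: restrict_apply)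
  qed
  have int': "integrable M (\<lambda>\<omega>. ?F (?past \<omega>))"
    by (rule Bochner_Integration.integrable_cong[THEN iffD2, OF refl F_eq int])
  have "integrable M (\<lambda>\<omega>. ?F (?past \<omega>) * h (step n \<omega>))"
    by (rule indep_var_integrable[OF * int' step_expectation(1)])
  then show "integrable M (\<lambda>\<omega>. f (X n \<omega>) (alive n \<omega>) * h (step n \<omega>))"
    by (rule Bochner_Integration.integrable_cong[THEN iffD1, rotated -1]) (simp_all only: F_eq)
  have "expectation (\<lambda>\<omega>. f (X n \<omega>) (alive n \<omega>) * h (step n \<omega>))
      = expectation (\<lambda>\<omega>. ?F (?past \<omega>) * h (step n \<omega>))"
    by (rule Bochner_Integration.integral_cong) (simp_all only: F_eq)
  also have "\<dots> = expectation (\<lambda>\<omega>. ?F (?past \<omega>)) * expectation (\<lambda>\<omega>. h (step n \<omega>))"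
    by (rule indep_var_lebesgue_integral[OF * int' step_expectation(1)])
  also have "expectation (\<lambda>\<omega>. ?F (?past \<omega>)) = expectation (\<lambda>\<omega>. f (X n \<omega>) (alive n \<omega>))"
    by (rule Bochner_Integration.integral_cong) (simp_all only: F_eq)
  finally show "expectation (\<lambda>\<omega>. f (X n \<omega>) (alive n \<omega>) * h (step n \<omega>))
      = expectation (\<lambda>\<omega>. f (X n \<omega>) (alive n \<omega>)) * (q * h (- int d) + (1 - q) * h (int e))"
    by (simp only: step_expectation(2))
qed

section \<open>Positivity and bounds before the hitting time\<close>

lemma q_nonneg: "0 \<le> q" and q_le_1: "q \<le> 1"
  unfolding prob_down[of 0, symmetric] by simp_all

lemma alive_Suc: "alive (Suc n) \<omega> \<longleftrightarrow> alive n \<omega> \<and> X (Suc n) \<omega> \<noteq> 0"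
  by (auto simp: alive_def le_Suc_eq)

text \<open>All positions are multiples of \<open>d\<close>, since \<open>a\<close> and
  \<open>e\<close> are. A positive one is at least \<open>d\<close>, so the next is at least 0, and
  survival excludes 0.\<close>

lemma AE_alive_pos: "AE \<omega> in M. \<forall>n. alive n \<omega> \<longrightarrow> 0 < X n \<omega>"
  using AE_steps AE_space
proof eventually_elim
  fix \<omega> assume st: "\<forall>t. step t \<omega> = - int d \<or> step t \<omega> = int e" and \<omega>: "\<omega> \<in> space M"
  have X_Suc: "X (Suc n) \<omega> = X n \<omega> - int d \<or> X (Suc n) \<omega> = X n \<omega> + int e" for n
    using st[rule_format, of n] by linarith
  have dvd: "int d dvd X n \<omega>" for n
  proof (induction n)
    case (Suc n)
    then show ?case
      using X_Suc[of n] d_dvd_e by (auto intro: dvd_add dvd_diff)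
  qed (use start[OF \<omega>] d_dvd_a in simp)
  have "0 < X n \<omega>" if "alive n \<omega>" for n
    using that
  proof (induction n)
    case (Suc n)
    then have "int d \<le> X n \<omega>"
      using dvd[of n] by (auto simp: alive_Suc intro: zdvd_imp_le)
    then have "0 \<le> X (Suc n) \<omega>"
      using X_Suc[of n] by auto
    with Suc.prems show ?case
      by (auto simp: alive_Suc)
  qed (use start[OF \<omega>] in \<open>auto simp: alive_def\<close>)
  then show "\<forall>n. alive n \<omega> \<longrightarrow> 0 < X n \<omega>" by blast
qed

lemma AE_X_le: "AE \<omega> in M. \<forall>n. X n \<omega> \<le> int (a + n * e)"
  using AE_steps AE_space
proof eventually_elim
  fix \<omega> assume st: "\<forall>t. step t \<omega> = - int d \<or> step t \<omega> = int e" and \<omega>: "\<omega> \<in> space M"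
  have "X n \<omega> \<le> int (a + n * e)" for n
  proof (induction n)
    case (Suc n)
    then show ?case
      using st[rule_format, of n] by auto
  qed (simp add: start[OF \<omega>])
  then show "\<forall>n. X n \<omega> \<le> int (a + n * e)" by blast
qed

text \<open>While alive, the position lies between 0 and \<open>a + n * e\<close>, so a monotone
  function of it is bounded.\<close>

lemma integrable_alive:
  fixes f :: "int \<Rightarrow> real"
  assumes mono: "\<And>x y. 0 \<le> x \<Longrightarrow> x \<le> y \<Longrightarrow> f x \<le> f y" and nonneg: "\<And>x. 0 \<le> x \<Longrightarrow> 0 \<le> f x"
  shows "integrable M (\<lambda>\<omega>. if alive n \<omega> then f (X n \<omega>) else 0)"
proof (rule integrable_const_bound[where B = "f (int (a + n * e))"])
  show "AE \<omega> in M. norm (if alive n \<omega> then f (X n \<omega>) else 0) \<le> f (int (a + n * e))"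
    using AE_alive_pos AE_X_le
  proof eventually_elim
    case (elim \<omega>)
    show ?case
    proof (cases "alive n \<omega>")
      case True
      with elim have "0 \<le> X n \<omega>" "X n \<omega> \<le> int (a + n * e)"
        by (auto intro: less_imp_le)
      with True mono[OF this] nonneg[of "X n \<omega>"] show ?thesis
        by simp
    qed (use nonneg[of "int (a + n * e)"] in simp)
  qed
qed measurable

section \<open>Exponential and linear moments of the surviving walk\<close>

lemma alive_powi_bound:
  assumes "1 < \<rho>"
  shows "expectation (\<lambda>\<omega>. if alive n \<omega> then \<rho> powi X n \<omega> else 0)
    \<le> \<rho> ^ a * (q * \<rho> powi (- int d) + (1 - q) * \<rho> powi int e) ^ n"
proof (induction n)
  case 0
  have "expectation (\<lambda>\<omega>. if alive 0 \<omega> then \<rho> powi X 0 \<omega> else 0) \<le> expectation (\<lambda>\<omega>. \<rho> ^ a)"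
  proof (rule integral_mono)
    show "integrable M (\<lambda>\<omega>. if alive 0 \<omega> then \<rho> powi X 0 \<omega> else 0)"
      by (rule integrable_alive) (use assms in \<open>auto intro: power_int_increasing\<close>)
  qed (use assms in \<open>auto simp: start\<close>)
  then show ?case by (simp add: prob_space)
next
  case (Suc n)
  let ?phi = "q * \<rho> powi (- int d) + (1 - q) * \<rho> powi int e"
  let ?f = "\<lambda>x b. if b then \<rho> powi x else 0"
  have int: "integrable M (\<lambda>\<omega>. ?f (X n \<omega>) (alive n \<omega>))" for n
    by (rule integrable_alive) (use assms in \<open>auto intro: power_int_increasing\<close>)
  \<comment> \<open>Weakening survival to time \<open>n + 1\<close> to survival to time
    \<open>n\<close> only enlarges the nonnegative integrand; the new step then contributes the
    factor \<open>?phi\<close>.\<close>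
  have "expectation (\<lambda>\<omega>. ?f (X (Suc n) \<omega>) (alive (Suc n) \<omega>))
      \<le> expectation (\<lambda>\<omega>. ?f (X n \<omega>) (alive n \<omega>) * \<rho> powi step n \<omega>)"
  proof (rule integral_mono[OF int expectation_past_step(1)[where f = ?f, OF int]])
    fix \<omega>
    have "\<rho> powi X (Suc n) \<omega> = \<rho> powi X n \<omega> * \<rho> powi step n \<omega>"
      using assms by (subst power_int_add[symmetric]) auto
    then show "?f (X (Suc n) \<omega>) (alive (Suc n) \<omega>) \<le> ?f (X n \<omega>) (alive n \<omega>) * \<rho> powi step n \<omega>"
      using assms by (auto simp: alive_Suc)
  qed
  also have "\<dots> = expectation (\<lambda>\<omega>. ?f (X n \<omega>) (alive n \<omega>)) * ?phi"
    by (rule expectation_past_step(2)[where f = ?f, OF int])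
  also have "\<dots> \<le> (\<rho> ^ a * ?phi ^ n) * ?phi"
    using Suc q_nonneg q_le_1 assms by (intro mult_right_mono add_nonneg_nonneg mult_nonneg_nonneg) auto
  finally show ?case
    by (simp add: mult_ac)
qed

lemma expectation_alive_X:
  "expectation (\<lambda>\<omega>. if alive n \<omega> then real_of_int (X n \<omega>) else 0)
    = real a - (q * real d - (1 - q) * real e) * (\<Sum>k<n. prob {\<omega>\<in>space M. alive k \<omega>})"
proof (induction n)
  case 0
  have "expectation (\<lambda>\<omega>. if alive 0 \<omega> then real_of_int (X 0 \<omega>) else 0) = expectation (\<lambda>\<omega>. real a)"
    by (rule Bochner_Integration.integral_cong) (auto simp: start alive_def)
  then show ?case by (simp add: prob_space)
next
  case (Suc n)
  let ?f = "\<lambda>x b. if b then real_of_int x else 0"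
  let ?g = "\<lambda>x b. if b then 1 else 0 :: real"
  have int: "integrable M (\<lambda>\<omega>. ?f (X n \<omega>) (alive n \<omega>))"
    by (rule integrable_alive) auto
  have int1: "integrable M (\<lambda>\<omega>. ?g (X n \<omega>) (alive n \<omega>))"
    by (rule integrable_alive) auto
  \<comment> \<open>Here the weakening is exact: a path that hits 0 at time \<open>n + 1\<close>
    contributes \<open>X (Suc n) = 0\<close> on either side.\<close>
  have "(\<lambda>\<omega>. ?f (X (Suc n) \<omega>) (alive (Suc n) \<omega>))
      = (\<lambda>\<omega>. ?f (X n \<omega>) (alive n \<omega>) + ?g (X n \<omega>) (alive n \<omega>) * real_of_int (step n \<omega>))"
    by (auto simp: alive_Suc)
  then have "expectation (\<lambda>\<omega>. ?f (X (Suc n) \<omega>) (alive (Suc n) \<omega>))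
      = expectation (\<lambda>\<omega>. ?f (X n \<omega>) (alive n \<omega>)
          + ?g (X n \<omega>) (alive n \<omega>) * real_of_int (step n \<omega>))"
    by simp
  also have "\<dots> = expectation (\<lambda>\<omega>. ?f (X n \<omega>) (alive n \<omega>))
      + expectation (\<lambda>\<omega>. ?g (X n \<omega>) (alive n \<omega>) * real_of_int (step n \<omega>))"
    by (rule Bochner_Integration.integral_add
        [OF int expectation_past_step(1)[where f = ?g and h = real_of_int, OF int1]])
  also have "expectation (\<lambda>\<omega>. ?g (X n \<omega>) (alive n \<omega>) * real_of_int (step n \<omega>))
      = expectation (\<lambda>\<omega>. ?g (X n \<omega>) (alive n \<omega>)) * (q * - real d + (1 - q) * real e)"
    using expectation_past_step(2)[where f = ?g and h = real_of_int, OF int1] by simp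
  also have "expectation (\<lambda>\<omega>. ?g (X n \<omega>) (alive n \<omega>))
      = expectation (indicator {\<omega>\<in>space M. alive n \<omega>})"
    by (rule Bochner_Integration.integral_cong) (auto simp: indicator_def)
  also have "\<dots> = prob {\<omega>\<in>space M. alive n \<omega>}"
    by simp
  finally show ?case
    using Suc by (simp add: algebra_simps)
qed

section \<open>Tail and mean of the hitting time\<close>

lemma prob_alive_le:
  assumes "1 < \<rho>"
  shows "prob {\<omega>\<in>space M. alive n \<omega>}
    \<le> \<rho> ^ a * (q * \<rho> powi (- int d) + (1 - q) * \<rho> powi int e) ^ n"
proof -
  have "prob {\<omega>\<in>space M. alive n \<omega>} = expectation (indicator {\<omega>\<in>space M. alive n \<omega>})"
    by simp
  \<comment> \<open>A surviving path has \<open>X n > 0\<close>, so its weight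
    \<open>\<rho> powi X n\<close> is at least 1.\<close>
  also have "\<dots> \<le> expectation (\<lambda>\<omega>. if alive n \<omega> then \<rho> powi X n \<omega> else 0)"
  proof (rule integral_mono_AE)
    show "integrable M (\<lambda>\<omega>. if alive n \<omega> then \<rho> powi X n \<omega> else 0)"
      by (rule integrable_alive) (use assms in \<open>auto intro: power_int_increasing\<close>)
    show "AE \<omega> in M. indicator {\<omega>\<in>space M. alive n \<omega>} \<omega> \<le> (if alive n \<omega> then \<rho> powi X n \<omega> else 0)"
      using AE_alive_pos
      by eventually_elim (use assms in \<open>auto simp: indicator_def less_imp_le one_le_power_int\<close>)
  qed (simp add: integrable_indicator_iff emeasure_eq_measure)
  also note alive_powi_bound[OF assms]
  finally show ?thesis .
qed

text \<open>As a function of \<rho> the expression equals 1 at \<rho> = 1, and its derivative there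
  is the drift, which is negative.\<close>

lemma ex_contraction: "\<exists>\<rho>>1. q * \<rho> powi (- int d) + (1 - q) * \<rho> powi int e < 1"
proof -
  let ?phi = "\<lambda>x :: real. q * x powi (- int d) + (1 - q) * x powi int e"
  have "(?phi has_real_derivative (q * - real d + (1 - q) * real e)) (at 1)"
    by (auto intro!: derivative_eq_intros)
  from DERIV_neg_dec_right[OF this] drift
  obtain \<epsilon> where "0 < \<epsilon>" "\<And>h. 0 < h \<Longrightarrow> h < \<epsilon> \<Longrightarrow> ?phi (1 + h) < ?phi 1"
    by auto
  from this(1) this(2)[of "\<epsilon> / 2"] show ?thesis
    by (intro exI[of _ "1 + \<epsilon> / 2"]) auto
qed

text \<open>\<open>expectation_alive_X\<close> is solved for the partial sums. What remains is that
  the surviving mean position tends to 0, which follows from the exponential bound.\<close>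

lemma sums_prob_alive:
  "(\<lambda>n. prob {\<omega>\<in>space M. alive n \<omega>}) sums (real a / (q * real d - (1 - q) * real e))"
proof -
  let ?delta = "q * real d - (1 - q) * real e"
  let ?e = "\<lambda>n. expectation (\<lambda>\<omega>. if alive n \<omega> then real_of_int (X n \<omega>) else 0)"
  obtain \<rho> where \<rho>: "1 < \<rho>" and phi_less: "q * \<rho> powi (- int d) + (1 - q) * \<rho> powi int e < 1"
    using ex_contraction by auto
  define phi where "phi = q * \<rho> powi (- int d) + (1 - q) * \<rho> powi int e"
  have phi: "0 \<le> phi" "phi < 1"
    using phi_less q_nonneg q_le_1 \<rho> by (auto simp: phi_def intro!: add_nonneg_nonneg mult_nonneg_nonneg)
  have int: "integrable M (\<lambda>\<omega>. if alive n \<omega> then \<rho> powi X n \<omega> else 0)" for n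
    by (rule integrable_alive) (use \<rho> in \<open>auto intro: power_int_increasing\<close>)
  have upper: "?e n \<le> \<rho> ^ a * phi ^ n / (\<rho> - 1)" for n
  proof -
    have "?e n \<le> expectation (\<lambda>\<omega>. (if alive n \<omega> then \<rho> powi X n \<omega> else 0) / (\<rho> - 1))"
    proof (rule integral_mono_AE)
      show "integrable M (\<lambda>\<omega>. if alive n \<omega> then real_of_int (X n \<omega>) else 0)"
        by (rule integrable_alive) auto
      show "AE \<omega> in M. (if alive n \<omega> then real_of_int (X n \<omega>) else 0)
          \<le> (if alive n \<omega> then \<rho> powi X n \<omega> else 0) / (\<rho> - 1)"
        using AE_alive_pos
      proof eventually_elim
        case (elim \<omega>)
        show ?case
        proof (cases "alive n \<omega>")
          case True
          then obtain m where m: "X n \<omega> = int m"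
            using elim by (metis zero_less_imp_eq_int)
          \<comment> \<open>Bernoulli's inequality gives m \<le>
            \<open>\<rho> ^ m / (\<rho> - 1)\<close>, which compares the linear moment with the
            exponential one.\<close>
          have "1 + real m * (\<rho> - 1) \<le> (1 + (\<rho> - 1)) ^ m"
            using \<rho> by (intro Bernoulli_inequality) auto
          then show ?thesis
            using True \<rho> by (simp add: m field_simps)
        qed simp
      qed
    qed (use int in simp)
    also have "\<dots> \<le> \<rho> ^ a * phi ^ n / (\<rho> - 1)"
      using alive_powi_bound[OF \<rho>, of n] \<rho> by (simp add: phi_def divide_right_mono)
    finally show ?thesis .
  qed
  have lower: "0 \<le> ?e n" for n
    by (rule integral_nonneg_AE) (use AE_alive_pos in \<open>eventually_elim, auto intro: less_imp_le\<close>)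
  have delta: "?delta \<noteq> 0"
    using drift by linarith
  have lim: "(\<lambda>n. \<rho> ^ a * phi ^ n / (\<rho> - 1)) \<longlonglongrightarrow> 0"
    using phi \<rho> by (intro tendsto_divide_zero tendsto_mult_right_zero LIMSEQ_realpow_zero)
  have "?e \<longlonglongrightarrow> 0"
    by (rule tendsto_sandwich[OF always_eventually always_eventually tendsto_const lim])
      (intro allI lower upper)+
  then have "(\<lambda>n. (real a - ?e n) / ?delta) \<longlonglongrightarrow> (real a - 0) / ?delta"
    using delta by (intro tendsto_intros)
  moreover have "(real a - ?e n) / ?delta = (\<Sum>k<n. prob {\<omega>\<in>space M. alive k \<omega>})" for n
    using delta by (subst expectation_alive_X) simp
  ultimately show ?thesis
    by (simp add: sums_def)
qed

lemma nn_integral_hit: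
  "(\<integral>\<^sup>+\<omega>. ennreal_of_enat (hit \<omega>) \<partial>M) = ennreal (real a / (q * real d - (1 - q) * real e))"
proof -
  have "(\<integral>\<^sup>+\<omega>. ennreal_of_enat (hit \<omega>) \<partial>M) = (\<Sum>n. ennreal (prob {\<omega>\<in>space M. alive n \<omega>}))"
    by (subst nn_integral_enat_function) (simp_all add: less_hit_iff emeasure_eq_measure)
  also have "\<dots> = ennreal (real a / (q * real d - (1 - q) * real e))"
    by (rule suminf_ennreal_eq[OF _ sums_prob_alive]) simp
  finally show ?thesis .
qed

lemma AE_hit_finite: "AE \<omega> in M. hit \<omega> \<noteq> \<infinity>"
proof -
  have "AE \<omega> in M. ennreal_of_enat (hit \<omega>) \<noteq> \<infinity>"
    by (rule nn_integral_PInf_AE) (simp_all add: nn_integral_hit)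
  then show ?thesis
    by eventually_elim (metis ennreal_of_enat_infty infinity_ennreal_def)
qed

lemma hit_geometric_tail:
  "\<exists>C x. 0 \<le> x \<and> x < 1 \<and> (\<forall>n. prob {\<omega>\<in>space M. enat n < hit \<omega>} \<le> C * x ^ n)"
proof -
  obtain \<rho> where \<rho>: "1 < \<rho>" and less: "q * \<rho> powi (- int d) + (1 - q) * \<rho> powi int e < 1"
    using ex_contraction by auto
  have "0 \<le> q * \<rho> powi (- int d) + (1 - q) * \<rho> powi int e"
    using q_nonneg q_le_1 \<rho> by (intro add_nonneg_nonneg mult_nonneg_nonneg) auto
  with less prob_alive_le[OF \<rho>] show ?thesis
    unfolding less_hit_iff by blast
qed

end

section \<open>The two walks of the approximation\<close>

lemma p_walk_skip_free:
  assumes "p_walk M p (int a) A" and "p < 1 / 2"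
  shows "skip_free_walk M A a 1 1 (1 - p)"
proof -
  interpret prob_space M
    using assms by (simp add: p_walk_def)
  show ?thesis
    by unfold_locales (use assms in \<open>auto simp: p_walk_def\<close>)
qed

text \<open>The distance from \<open>t - A\<^sub>t\<close> to its target \<open>n + 2\<close>, which decreases by 2 or stays put.\<close>

lemma p_walk_lag_skip_free:
  assumes A: "p_walk M (1 - \<eta>) (int l - 1) A" and "0 < \<eta>" and "even (n + l + 1)"
  shows "skip_free_walk M (\<lambda>t \<omega>. int n + 2 - (int t - A t \<omega>)) (n + l + 1) 2 0 \<eta>"
proof -
  interpret prob_space M
    using A by (simp add: p_walk_def)
  \<comment> \<open>A step +1 of \<open>A\<close> leaves the distance unchanged, and a step -1
    lowers it by 2.\<close>
  have step: "int n + 2 - (int (Suc t) - A (Suc t) \<omega>) - (int n + 2 - (int t - A t \<omega>))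
      = A (Suc t) \<omega> - A t \<omega> - 1" for t \<omega>
    by simp
  have eqs: "x - y - 1 = - int 2 \<longleftrightarrow> x - y = - 1" "x - y - 1 = int 0 \<longleftrightarrow> x - y = 1" for x y :: int
    by auto
  show ?thesis
  proof unfold_locales
    have "indep_vars (\<lambda>_. count_space UNIV) (\<lambda>t \<omega>. A (Suc t) \<omega> - A t \<omega>) UNIV"
      using A by (simp add: p_walk_def)
    from indep_vars_compose2[OF this, of "\<lambda>_ x. x - 1" "\<lambda>_. count_space UNIV"]
    show "indep_vars (\<lambda>_. count_space UNIV) (\<lambda>t \<omega>. int n + 2 - (int (Suc t) - A (Suc t) \<omega>)
        - (int n + 2 - (int t - A t \<omega>))) UNIV"
      unfolding step by simp
  next
    fix t
    show "prob {\<omega>\<in>space M. int n + 2 - (int (Suc t) - A (Suc t) \<omega>)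
        - (int n + 2 - (int t - A t \<omega>)) = - int 2} = \<eta>"
      unfolding step eqs using A by (simp add: p_walk_def)
    show "prob {\<omega>\<in>space M. int n + 2 - (int (Suc t) - A (Suc t) \<omega>)
        - (int n + 2 - (int t - A t \<omega>)) = int 0} = 1 - \<eta>"
      unfolding step eqs using A by (simp add: p_walk_def)
  qed (use A assms in \<open>auto simp: p_walk_def\<close>)
qed

text \<open>The sum of position, time and start keeps its parity under unit steps. This makes the
  initial distance \<open>n + l + 1\<close> of the second walk even, so that moves by 2 can reach
  0.\<close>

lemma s_A1_parity:
  assumes A: "p_walk M p (int a) A" and "p < 1 / 2"
  shows "AE \<omega> in M. \<forall>n. s_A1 A \<omega> = enat n \<longrightarrow> even (n + a)"
proof -
  interpret skip_free_walk M A a 1 1 "1 - p"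
    by (rule p_walk_skip_free[OF assms])
  show ?thesis
    using AE_steps AE_space
  proof eventually_elim
    fix \<omega> assume st: "\<forall>t. step t \<omega> = - int 1 \<or> step t \<omega> = int 1" and \<omega>: "\<omega> \<in> space M"
    have parity: "even (A t \<omega> + int t + int a)" for t
    proof (induction t)
      case (Suc t)
      from st have "A (Suc t) \<omega> = A t \<omega> + 1 \<or> A (Suc t) \<omega> = A t \<omega> - 1"
        by (metis add.commute diff_add_cancel diff_eq_eq of_nat_1 uminus_add_conv_diff)
      with Suc show ?case by auto
    qed (simp add: start[OF \<omega>])
    have "even (n + a)" if "s_A1 A \<omega> = enat n" for n
    proof -
      have "A n \<omega> = 0"
        using that by (simp add: s_A1_def first_time_eq_enat_iff)
      with parity[of n] show ?thesis by simp
    qed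
    then show "\<forall>n. s_A1 A \<omega> = enat n \<longrightarrow> even (n + a)" by blast
  qed
qed

text \<open>This is the second stopping time with the first one frozen at \<open>n\<close>; it
  depends on the second walk alone.\<close>

definition lag_time :: "(nat \<Rightarrow> 'w \<Rightarrow> int) \<Rightarrow> nat \<Rightarrow> 'w \<Rightarrow> enat" where
  "lag_time A n \<omega> = first_time (\<lambda>t. int t - A t \<omega> = int n + 2)"

lemma lag_time_eq_hit: "lag_time A n = skip_free_walk.hit (\<lambda>t \<omega>. int n + 2 - (int t - A t \<omega>))"
  if "skip_free_walk M (\<lambda>t \<omega>. int n + 2 - (int t - A t \<omega>)) a d e q"
proof -
  have "int t - A t \<omega> = int n + 2 \<longleftrightarrow> int n + 2 - (int t - A t \<omega>) = 0" for t \<omega>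
    by auto
  then show ?thesis
    by (simp add: fun_eq_iff lag_time_def skip_free_walk.hit_def[OF that] del: diff_eq_eq eq_diff_eq)
qed

lemma s_A2_eq_lag_time: "s_A1 A1 \<omega> = enat n \<Longrightarrow> s_A2 A1 A2 \<omega> = lag_time A2 n \<omega>"
  by (simp add: s_A2_def lag_time_def)

text \<open>Each time is a measurable function of one whole path, and the two paths are
  independent.\<close>

lemma indep_s_A1_lag_time:
  assumes "independent_walks M A1 A2" and "prob_space M"
  shows "prob_space.indep_var M (count_space UNIV) (s_A1 A1) (count_space UNIV) (lag_time A2 n)"
proof -
  interpret prob_space M by fact
  let ?P = "PiM UNIV (\<lambda>_. count_space UNIV) :: (nat \<Rightarrow> int) measure"
  have S: "(\<lambda>x. first_time (\<lambda>t. x t = 0)) \<in> measurable ?P (count_space UNIV)"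
    by measurable
  have U: "(\<lambda>x. first_time (\<lambda>t. int t - x t = int n + 2)) \<in> measurable ?P (count_space UNIV)"
    by measurable
  from indep_var_compose[OF assms(1)[unfolded independent_walks_def] S U] show ?thesis
    by (simp add: comp_def s_A1_def[abs_def] lag_time_def[abs_def])
qed

lemma measurable_s_A2:
  assumes [measurable]: "\<And>t. A1 t \<in> measurable M (count_space UNIV)"
    "\<And>t. A2 t \<in> measurable M (count_space UNIV)"
  shows "s_A2 A1 A2 \<in> measurable M (count_space UNIV)"
  unfolding s_A2_def[abs_def] s_A1_def by measurable

text \<open>The informal smallness of \<eta> is read as 0 < \<eta> < 1/2, where both the first walk
  and the distance of the second from its target have negative drift. The second conjunct confirms
  that the derivative is the expected time.\<close>

theorem theorem11:
  fixes M :: "'w measure"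
    and l :: nat
    and \<eta> :: real
    and A1 A2 :: "nat \<Rightarrow> 'w \<Rightarrow> int"
  assumes "l \<ge> 2"
    and "0 < \<eta>" and "\<eta> < 1 / 2"
    and "random_walk_approximation M l \<eta> A1 A2"
  shows "(G_II M A1 A2 has_real_derivative
            ((real l - \<eta> * real l - \<eta>) / (\<eta> - 2 * \<eta>\<^sup>2))) (at 1)
       \<and> (\<integral>\<^sup>+ \<omega>. ennreal_of_enat (s_A2 A1 A2 \<omega>) \<partial>M) =
            ennreal ((real l - \<eta> * real l - \<eta>) / (\<eta> - 2 * \<eta>\<^sup>2))"
proof -
  let ?E = "(real l - \<eta> * real l - \<eta>) / (\<eta> - 2 * \<eta>\<^sup>2)"
  have l: "int l - 1 = int (l - 1)"
    using assms(1) by simp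
  have A1: "p_walk M \<eta> (int (l - 1)) A1" and A2: "p_walk M (1 - \<eta>) (int l - 1) A2"
    and indep_walks: "independent_walks M A1 A2"
    using assms(4) unfolding l by (simp_all add: random_walk_approximation_def l)
  interpret W: skip_free_walk M A1 "l - 1" 1 1 "1 - \<eta>"
    by (rule p_walk_skip_free[OF A1 assms(3)])
  let ?S = "s_A1 A1" and ?T = "s_A2 A1 A2" and ?U = "lag_time A2"
  have S_hit: "?S = W.hit"
    by (simp add: fun_eq_iff s_A1_def W.hit_def)
  have S_meas [measurable]: "?S \<in> measurable M (count_space UNIV)"
    unfolding S_hit by simp
  have A2_meas: "A2 t \<in> measurable M (count_space UNIV)" for t
  proof -
    have "(\<lambda>\<omega>. (\<lambda>t. A2 t \<omega>) t) \<in> measurable M (count_space UNIV)"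
      by (rule measurable_compose[OF W.indep_var_rv2[OF indep_walks[unfolded independent_walks_def]]])
        simp
    then show ?thesis by simp
  qed
  have T_meas [measurable]: "?T \<in> measurable M (count_space UNIV)"
    by (intro measurable_s_A2 W.X_measurable A2_meas)
  have fin: "AE \<omega> in M. ?S \<omega> \<noteq> \<infinity>"
    using W.AE_hit_finite by (simp add: S_hit)
  have indep: "W.indep_var (count_space UNIV) ?S (count_space UNIV) (?U n)" for n
    by (rule indep_s_A1_lag_time[OF indep_walks W.prob_space_axioms])
  have eq: "?S \<omega> = enat n \<Longrightarrow> ?T \<omega> = ?U n \<omega>" for n \<omega>
    by (rule s_A2_eq_lag_time)

  define p where "p n = W.prob {\<omega>\<in>space M. ?S \<omega> = enat n}" for n
  have emeasure_p: "emeasure M {\<omega>\<in>space M. ?S \<omega> = enat n} = ennreal (p n)" for n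
    by (simp add: p_def W.emeasure_eq_measure)
  have p_nonneg: "0 \<le> p n" for n
    by (simp add: p_def)
  \<comment> \<open>For these \<open>n\<close> the second walk would almost surely miss its target
    and \<open>?U n\<close> would have infinite mean; the weight 0 removes them from the sums
    below.\<close>
  have p_odd: "p n = 0" if "odd (n + l + 1)" for n
  proof -
    have "odd (n + (l - 1))"
      using that assms(1) by presburger
    have "AE \<omega> in M. \<not> ?S \<omega> = enat n"
      using s_A1_parity[OF A1 assms(3)] by eventually_elim (use \<open>odd (n + (l - 1))\<close> in blast)
    then have "W.prob {\<omega>\<in>space M. ?S \<omega> = enat n} = 0"
      by (subst W.prob_eq_0) auto
    then show ?thesis by (simp add: p_def)
  qed

  have "(\<integral>\<^sup>+\<omega>. ennreal_of_enat (?T \<omega>) \<partial>M)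
      = (\<Sum>n. emeasure M {\<omega>\<in>space M. ?S \<omega> = enat n} * (\<integral>\<^sup>+\<omega>. ennreal_of_enat (?U n \<omega>) \<partial>M))"
    by (rule W.mixture_mean[OF T_meas fin indep eq])
  also have "\<dots> = (\<Sum>n. (ennreal_of_enat (enat n) + ennreal (real l + 1)) * ennreal (1 / (2 * \<eta>))
      * emeasure M {\<omega>\<in>space M. ?S \<omega> = enat n})"
  proof (rule suminf_cong)
    fix n
    show "emeasure M {\<omega>\<in>space M. ?S \<omega> = enat n} * (\<integral>\<^sup>+\<omega>. ennreal_of_enat (?U n \<omega>) \<partial>M)
      = (ennreal_of_enat (enat n) + ennreal (real l + 1)) * ennreal (1 / (2 * \<eta>))
        * emeasure M {\<omega>\<in>space M. ?S \<omega> = enat n}"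
    proof (cases "even (n + l + 1)")
      case True
      note lag = p_walk_lag_skip_free[OF A2 assms(2) True]
      have "(\<integral>\<^sup>+\<omega>. ennreal_of_enat (?U n \<omega>) \<partial>M) = ennreal (real (n + l + 1) / (2 * \<eta>))"
        unfolding lag_time_eq_hit[OF lag] skip_free_walk.nn_integral_hit[OF lag] by (simp add: mult.commute)
      also have "\<dots> = ennreal ((real n + (real l + 1)) * (1 / (2 * \<eta>)))"
        by (simp add: add_ac)
      also have "\<dots> = (ennreal_of_enat (enat n) + ennreal (real l + 1)) * ennreal (1 / (2 * \<eta>))"
        using assms(2) by (simp add: ennreal_mult ennreal_plus ennreal_of_nat_eq_real_of_nat del: times_divide_eq_right)
      finally show ?thesis
        by (simp only: mult.commute)
    qed (simp add: emeasure_p p_odd)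
  qed
  \<comment> \<open>The conditional mean (n + l + 1)/(2\<eta>) is affine in \<open>n\<close>, so
    only the mean of the first stopping time enters.\<close>
  also have "\<dots> = (\<integral>\<^sup>+\<omega>. (ennreal_of_enat (?S \<omega>) + ennreal (real l + 1)) * ennreal (1 / (2 * \<eta>)) \<partial>M)"
    by (rule W.nn_integral_AE_finite_enat[OF S_meas fin, symmetric])
  also have "\<dots> = ((\<integral>\<^sup>+\<omega>. ennreal_of_enat (?S \<omega>) \<partial>M) + ennreal (real l + 1)) * ennreal (1 / (2 * \<eta>))"
    by (simp add: nn_integral_multc nn_integral_add W.emeasure_space_1)
  also have "(\<integral>\<^sup>+\<omega>. ennreal_of_enat (?S \<omega>) \<partial>M) = ennreal ((real l - 1) / (1 - 2 * \<eta>))"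
    unfolding S_hit W.nn_integral_hit using assms(1) by (simp add: of_nat_diff)
  also have "(ennreal ((real l - 1) / (1 - 2 * \<eta>)) + ennreal (real l + 1)) * ennreal (1 / (2 * \<eta>))
      = ennreal (((real l - 1) / (1 - 2 * \<eta>) + (real l + 1)) * (1 / (2 * \<eta>)))"
  proof -
    have nonneg: "0 \<le> (real l - 1) / (1 - 2 * \<eta>)" "0 \<le> real l + 1" "0 \<le> 1 / (2 * \<eta>)"
      using assms(1-3) by auto
    show ?thesis
      unfolding ennreal_plus[OF nonneg(1,2), symmetric]
      by (rule ennreal_mult[symmetric]) (intro add_nonneg_nonneg nonneg)+
  qed
  also have "((real l - 1) / (1 - 2 * \<eta>) + (real l + 1)) * (1 / (2 * \<eta>)) = ?E"
  proof -
    have "\<eta> - 2 * \<eta>\<^sup>2 = \<eta> * (1 - 2 * \<eta>)"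
      by (simp add: power2_eq_square algebra_simps)
    with assms(2,3) show ?thesis
      by (simp add: divide_simps) (simp add: algebra_simps)
  qed
  finally have mean: "(\<integral>\<^sup>+\<omega>. ennreal_of_enat (?T \<omega>) \<partial>M) = ennreal ?E" .

  \<comment> \<open>\<open>ennreal\<close> sends negative reals to 0, so the sign is needed to
    recover \<open>?E\<close> from \<open>mean\<close>.\<close>
  have E_nonneg: "0 \<le> ?E"
  proof (rule divide_nonneg_nonneg)
    have "\<eta> * (real l + 1) \<le> (1 / 2) * (real l + 1)"
      using assms(3) by (intro mult_right_mono) auto
    then show "0 \<le> real l - \<eta> * real l - \<eta>"
      using assms(1) by (simp add: algebra_simps)
    have "\<eta> * (2 * \<eta>) \<le> \<eta> * 1"
      using assms(2,3) by (intro mult_left_mono) auto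
    then show "0 \<le> \<eta> - 2 * \<eta>\<^sup>2"
      by (simp add: power2_eq_square algebra_simps)
  qed

  obtain \<rho> where \<rho>: "1 < \<rho>" and sm_p: "summable (\<lambda>n. p n * \<rho> ^ n)"
    using W.hit_geometric_tail W.geometric_tail_summable[OF S_meas] unfolding S_hit p_def by blast
  \<comment> \<open>The mean of \<rho> to the power of one change of distance. As the distance never
    grows, this is below 1 for every \<rho> > 1, so \<rho> may be dictated by the first
    walk.\<close>
  define phi where "phi = \<eta> * \<rho> powi (- 2) + (1 - \<eta>)"
  have "\<rho> powi (- 2) < 1"
    using \<rho> by (simp add: power_int_minus power_int_numeral inverse_less_1_iff one_less_power)
  moreover have "0 < \<rho> powi (- 2)"
    using \<rho> by simp
  ultimately have phi: "0 \<le> phi" "phi < 1"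
    using assms(2,3) by (auto simp: phi_def add_nonneg_nonneg)
  \<comment> \<open>The expectation of \<rho> to the power of the random initial distance, finite by
    the exponential moment of the first stopping time.\<close>
  define C where "C = (\<Sum>n. p n * \<rho> ^ n * \<rho> ^ (l + 1))"
  have sm_C: "summable (\<lambda>n. p n * \<rho> ^ n * \<rho> ^ (l + 1))"
    by (rule summable_mult2[OF sm_p])
  have C_nonneg: "0 \<le> C"
    unfolding C_def by (rule suminf_nonneg[OF sm_C]) (use p_nonneg \<rho> in simp)
  have tail: "W.prob {\<omega>\<in>space M. enat k < ?T \<omega>} \<le> C * phi ^ k" for k
  proof -
    have "ennreal (W.prob {\<omega>\<in>space M. enat k < ?T \<omega>})
        = (\<Sum>n. ennreal (p n) * emeasure M {\<omega>\<in>space M. enat k < ?U n \<omega>})"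
      unfolding W.emeasure_eq_measure[symmetric] emeasure_p[symmetric]
      by (rule W.mixture_tail[OF T_meas fin indep eq])
    also have "\<dots> \<le> (\<Sum>n. ennreal (p n * \<rho> ^ n * \<rho> ^ (l + 1) * phi ^ k))"
    proof (rule suminf_le)
      fix n
      show "ennreal (p n) * emeasure M {\<omega>\<in>space M. enat k < ?U n \<omega>}
          \<le> ennreal (p n * \<rho> ^ n * \<rho> ^ (l + 1) * phi ^ k)"
      proof (cases "even (n + l + 1)")
        case True
        note lag = p_walk_lag_skip_free[OF A2 assms(2) True]
        have "W.prob {\<omega>\<in>space M. enat k < ?U n \<omega>} \<le> \<rho> ^ (n + l + 1) * phi ^ k"
          using skip_free_walk.prob_alive_le[OF lag \<rho>, of k]
          unfolding lag_time_eq_hit[OF lag] skip_free_walk.less_hit_iff[OF lag] phi_def by simp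
        then have "p n * W.prob {\<omega>\<in>space M. enat k < ?U n \<omega>} \<le> p n * (\<rho> ^ (n + l + 1) * phi ^ k)"
          by (rule mult_left_mono[OF _ p_nonneg])
        then show ?thesis
          unfolding W.emeasure_eq_measure ennreal_mult[OF p_nonneg measure_nonneg, symmetric]
          by (intro ennreal_leI) (simp add: power_add mult_ac)
      qed (simp add: p_odd)
    qed auto
    also have "\<dots> = ennreal (C * phi ^ k)"
    proof (rule suminf_ennreal_eq)
      show "(\<lambda>n. p n * \<rho> ^ n * \<rho> ^ (l + 1) * phi ^ k) sums (C * phi ^ k)"
        unfolding C_def by (rule sums_mult2[OF summable_sums[OF sm_C]])
    qed (use \<rho> p_nonneg phi in \<open>auto intro!: mult_nonneg_nonneg\<close>)
    finally show ?thesis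
      by (rule ennreal_le_iff[THEN iffD1, rotated])
        (intro mult_nonneg_nonneg zero_le_power C_nonneg phi(1))
  qed
  obtain r where "1 < r" "summable (\<lambda>k. W.prob {\<omega>\<in>space M. ?T \<omega> = enat k} * r ^ k)"
    using W.geometric_tail_summable[OF T_meas tail phi] by blast
  from W.generating_function_derivative[OF T_meas this mean E_nonneg]
  have "(G_II M A1 A2 has_real_derivative ?E) (at 1)"
    by (simp add: G_II_def[abs_def])
  with mean show ?thesis by blast
qed

end
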